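(* Let $G$ be an undirected graph on $V=\{1,\dots,n\}$ with adjacency matrix $A$. Consider the following procedure (BlindWL), which accesses $A$ only through an oracle $O$ returning $O(B)=AB$ for a chosen input matrix $B$. Start with $B=\mathbf 1_n\in\mathbb R^{n\times 1}$, the all-ones vector. While $O(B)\notin\operatorname{span}(B)$, replace $B$ by the $n\times n$ matrix $B'$ with $$B'_{i,j}=\begin{cases}1&\text{if } O(B)_{i,\_}=O(B)_{j,\_}\text{ and }B_{i,\_}=B_{j,\_},\\0&\text{otherwise,}\end{cases}$$ and then remove redundant (duplicate) columns from it. When the loop ends, return $B$. Then this procedure terminates and the returned matrix $B$ is the indicator matrix of the coarsest equitable partition of $G$ (up to the ordering of the columns).
   Context: Graphs: $G$ may carry self-loops and positive edge weights; its adjacency matrix $A$ is symmetric with $A_{uv}=w(uv)>0$ if $uv$ is an edge ($w=1$ in the unweighted case) and $A_{uv}=0$ otherwise. Notation: $M_{i,\_}$ is the $i$-th row of a matrix $M$. For $M\in\mathbb R^{n\times m}$, $\operatorname{span}(M)=\{Mv: v\in\mathbb R^m\}$, and for a matrix $X$ with $n$ rows, $X\in\operatorname{span}(M)$ means that every column of $X$ lies in $\operatorname{span}(M)$. Equitable partitions: a partition $\{C_1,\dots,C_k\}$ of the nodes into disjoint classes has indicator matrix $H\in\{0,1\}^{n\times k}$ with $H_{ij}=1$ iff $i\in C_j$. It is an equitable partition (EP) of $G$ if $AH=HA^\pi$ for some $k\times k$ matrix $A^\pi$; for an unweighted graph this says that $|N(u)\cap C_j|=|N(v)\cap C_j|$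 for all $j$ whenever $u,v$ lie in the same class, where $N(v)$ is the set of nodes adjacent to $v$. The coarsest EP is the EP with the fewest classes. *)

theory Defs
  imports
    "Jordan_Normal_Form.Matrix"
    "HOL-Library.While_Combinator"
    "HOL-Library.Disjoint_Sets"
begin

(* The n nodes are 0, ..., n - 1, matching the 0-based indices of the type mat.
   An edge is an unordered pair {u, v}; the singleton {u} is a self-loop at u.
   The unweighted case is w = (\<lambda>_. 1). *)
definition weighted_graph :: "nat \<Rightarrow> nat set set \<Rightarrow> (nat set \<Rightarrow> real) \<Rightarrow> bool" where
  "weighted_graph n E w \<longleftrightarrow>
     0 < n \<and> (\<forall>e\<in>E. \<exists>u v. u < n \<and> v < n \<and> e = {u, v}) \<and> (\<forall>e\<in>E. 0 < w e)"

definition adjacency_mat :: "nat \<Rightarrow> nat set set \<Rightarrow> (nat set \<Rightarrow> real) \<Rightarrow> real mat" where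
  "adjacency_mat n E w = mat n n (\<lambda>(u, v). if {u, v} \<in> E then w {u, v} else 0)"

definition mat_span :: "real mat \<Rightarrow> real vec set" where
  "mat_span M = {M *\<^sub>v v | v. v \<in> carrier_vec (dim_col M)}"

definition in_mat_span :: "real mat \<Rightarrow> real mat \<Rightarrow> bool" where
  "in_mat_span X M \<longleftrightarrow> (\<forall>j < dim_col X. col X j \<in> mat_span M)"

definition indicator_mat :: "nat \<Rightarrow> nat set list \<Rightarrow> real mat" where
  "indicator_mat n Cs = mat n (length Cs) (\<lambda>(i, j). if i \<in> Cs ! j then 1 else 0)"

(* The list Cs is an arbitrary enumeration C_1, ..., C_k of the classes in P, so H is
   determined by P only up to the order of its columns. *)
definition is_indicator_mat :: "nat \<Rightarrow> nat set set \<Rightarrow> real mat \<Rightarrow> bool" where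
  "is_indicator_mat n P H \<longleftrightarrow> (\<exists>Cs. distinct Cs \<and> set Cs = P \<and> H = indicator_mat n Cs)"

definition equitable_partition :: "nat \<Rightarrow> real mat \<Rightarrow> nat set set \<Rightarrow> bool" where
  "equitable_partition n A P \<longleftrightarrow> partition_on {..<n} P \<and>
     (\<exists>H Q. is_indicator_mat n P H \<and> Q \<in> carrier_mat (card P) (card P) \<and> A * H = H * Q)"

definition coarsest_EP :: "nat \<Rightarrow> real mat \<Rightarrow> nat set set \<Rightarrow> bool" where
  "coarsest_EP n A P \<longleftrightarrow> equitable_partition n A P \<and>
     (\<forall>P'. equitable_partition n A P' \<longrightarrow> card P \<le> card P')"

definition remove_duplicate_cols :: "real mat \<Rightarrow> real mat" where
  "remove_duplicate_cols M = mat_of_cols (dim_row M) (remdups (cols M))"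

definition refine_mat :: "nat \<Rightarrow> (real mat \<Rightarrow> real mat) \<Rightarrow> real mat \<Rightarrow> real mat" where
  "refine_mat n orc B =
     mat n n (\<lambda>(i, j). if row (orc B) i = row (orc B) j \<and> row B i = row B j then 1 else 0)"

(* The result is None iff the loop does not terminate. *)
definition blindWL :: "nat \<Rightarrow> (real mat \<Rightarrow> real mat) \<Rightarrow> real mat option" where
  "blindWL n orc =
     while_option (\<lambda>B. \<not> in_mat_span (orc B) B)
       (\<lambda>B. remove_duplicate_cols (refine_mat n orc B))
       (mat n 1 (\<lambda>_. 1))"

end

theory Submission
  imports Defs
begin

text \<open>
  The columns of the indicator matrix \<open>H\<close> of a partition \<open>P\<close> span exactly the vectors that are
  constant on every class of \<open>P\<close> (\<open>mat_span_indicator_iff\<close>). Hence \<open>A H = H Q\<close> has a solution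
  \<open>Q\<close> iff this space is invariant under \<open>A\<close>: the test of the loop is a test of equitability
  (\<open>equitable_partitionI\<close>), and for an equitable partition \<open>A\<close> preserves all class-constant vectors
  (\<open>equitable_partition_class_constant\<close>).

  The loop maintains that \<open>B\<close> is the indicator matrix of a partition \<open>P\<close> that every equitable
  partition \<open>P'\<close> refines. A round (\<open>refinement_round\<close>) preserves this: the columns of \<open>B\<close> are constant
  on the classes of \<open>P'\<close>, hence so are those of \<open>A B\<close>, so the round never separates two nodes of one
  class of \<open>P'\<close>. A round that is entered splits some class, since otherwise the rows of \<open>A B\<close> would
  agree within the classes of \<open>P\<close> and the test would have stopped the loop; thus the number of columns
  strictly increases, and it is at most \<open>n\<close>. When the loop stops, \<open>P\<close> is itself equitable and is
  refined by all equitable partitions. A proper refinement has more classes (\<open>refines_card\<close>), so \<open>P\<close>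
  is the unique equitable partition with the fewest classes (\<open>unique_coarsest_EP\<close>).
\<close>

section \<open>Refinement of finite partitions\<close>

lemma partition_on_same_class:
  assumes "partition_on S P" "C \<in> P" "D \<in> P" "i \<in> C" "i \<in> D"
  shows "C = D"
  using partition_onD2[OF assms(1)] assms(2-5) unfolding disjoint_def by blast

text \<open>
  Sending each class of \<open>P\<close> to the class of \<open>Q\<close> around it is onto, as the classes of \<open>Q\<close> are
  nonempty. If it is also injective, no class of \<open>Q\<close> contains two classes of \<open>P\<close>.
\<close>
lemma refines_card:
  assumes "finite S" and ref: "refines S P Q"
  shows "card Q \<le> card P" and "card P = card Q \<Longrightarrow> P = Q"
proof -
  have P: "partition_on S P" and Q: "partition_on S Q"
    using ref by (auto simp: refines_def)
  have fin: "finite P"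
    using P \<open>finite S\<close> by (rule finite_elements[rotated])
  obtain f where f: "\<And>X. X \<in> P \<Longrightarrow> f X \<in> Q" "\<And>X. X \<in> P \<Longrightarrow> X \<subseteq> f X"
    using ref unfolding refines_def by metis
  have f_eq: "\<exists>X\<in>P. a \<in> X \<and> f X = Y" if "Y \<in> Q" "a \<in> Y" for Y a
  proof -
    have "a \<in> S" using Q that by (auto simp: partition_on_def)
    then obtain X where "X \<in> P" "a \<in> X" using P by (auto simp: partition_on_def)
    then show ?thesis using partition_on_same_class[OF Q f(1) \<open>Y \<in> Q\<close>] f(2) that by blast
  qed
  have image: "f ` P = Q"
  proof
    show "Q \<subseteq> f ` P"
    proof
      fix Y assume "Y \<in> Q"
      then obtain a where "a \<in> Y" using partition_onD3[OF Q] by fastforce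
      then show "Y \<in> f ` P" using f_eq \<open>Y \<in> Q\<close> by blast
    qed
  qed (use f in blast)
  then show "card Q \<le> card P" using fin card_image_le by blast
  assume "card P = card Q"
  then have inj: "inj_on f P" using fin image by (simp add: eq_card_imp_inj_on)
  have "f X = X" if X: "X \<in> P" for X
  proof
    show "f X \<subseteq> X"
    proof
      fix a assume "a \<in> f X"
      then obtain X' where X': "X' \<in> P" "a \<in> X'" "f X' = f X"
        using f_eq[OF f(1)[OF X]] by blast
      have "X' = X" using inj X'(3,1) X by (rule inj_onD)
      then show "a \<in> X" using X'(2) by blast
    qed
  qed (use f X in blast)
  then have "f ` P = P" by (simp cong: image_cong)
  then show "P = Q" using image by simp
qed

section \<open>The column space of an indicator matrix\<close>

definition class_constant :: "nat set set \<Rightarrow> 'a vec \<Rightarrow> bool" where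
  "class_constant P x \<longleftrightarrow> (\<forall>C\<in>P. \<forall>i\<in>C. \<forall>j\<in>C. x $ i = x $ j)"

lemma is_indicator_matE:
  assumes "is_indicator_mat n P H" "partition_on {..<n} P"
  obtains Cs where "distinct Cs" "set Cs = P" "length Cs = card P" "H = indicator_mat n Cs"
    "H \<in> carrier_mat n (card P)"
proof -
  from assms(1) obtain Cs where Cs: "distinct Cs" "set Cs = P" "H = indicator_mat n Cs"
    by (auto simp: is_indicator_mat_def)
  moreover have "length Cs = card P" using Cs by (auto simp: distinct_card)
  ultimately show ?thesis using that by (simp add: indicator_mat_def)
qed

lemma row_indicator_mat_eq_iff:
  assumes H: "is_indicator_mat n P H" and P: "partition_on {..<n} P" and ij: "i < n" "j < n"
  shows "row H i = row H j \<longleftrightarrow> (\<exists>C\<in>P. i \<in> C \<and> j \<in> C)"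
proof -
  obtain Cs where Cs: "set Cs = P" "H = indicator_mat n Cs"
    using is_indicator_matE[OF H P] .
  have "row H i = row H j \<longleftrightarrow> (\<forall>l<length Cs. i \<in> Cs ! l \<longleftrightarrow> j \<in> Cs ! l)"
    using ij by (auto simp: Cs(2) indicator_mat_def vec_eq_iff split: if_splits)
  also have "\<dots> \<longleftrightarrow> (\<forall>C\<in>P. i \<in> C \<longleftrightarrow> j \<in> C)"
    unfolding Cs(1)[symmetric] all_set_conv_all_nth by simp
  also have "\<dots> \<longleftrightarrow> (\<exists>C\<in>P. i \<in> C \<and> j \<in> C)"
  proof
    assume "\<forall>C\<in>P. i \<in> C \<longleftrightarrow> j \<in> C"
    moreover obtain C where "C \<in> P" "i \<in> C" using P ij by (auto simp: partition_on_def)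
    ultimately show "\<exists>C\<in>P. i \<in> C \<and> j \<in> C" by blast
  next
    assume "\<exists>C\<in>P. i \<in> C \<and> j \<in> C"
    then show "\<forall>C\<in>P. i \<in> C \<longleftrightarrow> j \<in> C" using partition_on_same_class[OF P] by blast
  qed
  finally show ?thesis .
qed

lemma class_constant_cols_iff:
  assumes X: "X \<in> carrier_mat n m" and P: "partition_on {..<n} P"
  shows "(\<forall>k<m. class_constant P (col X k)) \<longleftrightarrow> (\<forall>C\<in>P. \<forall>i\<in>C. \<forall>j\<in>C. row X i = row X j)"
proof -
  have lt: "i < n" if "C \<in> P" "i \<in> C" for C i
    using P that by (auto simp: partition_on_def)
  have "row X i = row X j \<longleftrightarrow> (\<forall>k<m. col X k $ i = col X k $ j)" if "i < n" "j < n" for i j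
    using X that by (auto simp: vec_eq_iff)
  with lt show ?thesis unfolding class_constant_def by meson
qed

text \<open>
  For a class-constant vector, the coefficient of the column of a class is the common value of the
  vector on that class.
\<close>
lemma mat_span_indicator_iff:
  assumes H: "is_indicator_mat n P H" and P: "partition_on {..<n} P" and x: "x \<in> carrier_vec n"
  shows "x \<in> mat_span H \<longleftrightarrow> class_constant P x"
proof
  have lt: "i < n" if "C \<in> P" "i \<in> C" for C i
    using P that by (auto simp: partition_on_def)
  {
    assume "x \<in> mat_span H"
    then obtain v where v: "x = H *\<^sub>v v" by (auto simp: mat_span_def)
    have Hn: "dim_row H = n" using is_indicator_matE[OF H P] carrier_matD(1) by metis
    show "class_constant P x"
      unfolding class_constant_def
    proof (intro ballI)
      fix C i j assume C: "C \<in> P" "i \<in> C" "j \<in> C"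
      then have "row H i = row H j" using row_indicator_mat_eq_iff[OF H P] lt by blast
      then show "x $ i = x $ j" using C lt Hn by (simp add: v)
    qed
  }
  assume const: "class_constant P x"
  obtain Cs where Cs: "distinct Cs" "set Cs = P" "H = indicator_mat n Cs"
    using is_indicator_matE[OF H P] .
  \<comment> \<open>Classes are nonempty, so the choice yields a member; which one does not matter.\<close>
  define v where "v = vec (length Cs) (\<lambda>l. x $ (SOME i. i \<in> Cs ! l))"
  have "H *\<^sub>v v = x"
  proof (rule eq_vecI)
    fix i assume "i < dim_vec x"
    then have i: "i < n" using x by simp
    then obtain C where "C \<in> P" "i \<in> C" using P by (auto simp: partition_on_def)
    then obtain l where l: "l < length Cs" "i \<in> Cs ! l" using Cs by (auto simp: in_set_conv_nth)
    have only: "i \<in> Cs ! m \<longleftrightarrow> m = l" if "m < length Cs" for m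
      using partition_on_same_class[OF P, of "Cs ! m" "Cs ! l" i] Cs l that
      by (auto simp: nth_eq_iff_index_eq)
    have vl: "v $ l = x $ i"
    proof -
      have "(SOME i. i \<in> Cs ! l) \<in> Cs ! l" using l(2) by (rule someI)
      then have "x $ (SOME i. i \<in> Cs ! l) = x $ i"
        using const l Cs(2) nth_mem[OF l(1)] unfolding class_constant_def by blast
      then show ?thesis using l(1) by (simp add: v_def)
    qed
    have "(H *\<^sub>v v) $ i = (\<Sum>m<length Cs. (if i \<in> Cs ! m then 1 else 0) * v $ m)"
      using i by (simp add: Cs(3) indicator_mat_def v_def scalar_prod_def lessThan_atLeast0)
    also have "\<dots> = (\<Sum>m<length Cs. if m = l then v $ m else 0)"
      by (rule sum.cong) (auto simp: only)
    also have "\<dots> = x $ i" using l vl by simp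
    finally show "(H *\<^sub>v v) $ i = x $ i" .
  qed (use x in \<open>simp add: Cs(3) indicator_mat_def\<close>)
  moreover have "v \<in> carrier_vec (dim_col H)" by (simp add: v_def Cs(3) indicator_mat_def)
  ultimately show "x \<in> mat_span H" unfolding mat_span_def by blast
qed

lemma class_constant_col_indicator:
  assumes H: "is_indicator_mat n P H" and P: "partition_on {..<n} P" and k: "k < card P"
  shows "class_constant P (col H k)"
proof -
  have Hc: "H \<in> carrier_mat n (card P)" using is_indicator_matE[OF H P] .
  have "i < n" if "C \<in> P" "i \<in> C" for C i
    using P that by (auto simp: partition_on_def)
  then show ?thesis
    using class_constant_cols_iff[OF Hc P] row_indicator_mat_eq_iff[OF H P] k by blast
qed

section \<open>Equitable partitions as invariant subspaces\<close>

text \<open>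
  From \<open>A H = H Q\<close> it follows that \<open>A (H v) = H (Q v)\<close>. Unlike \<open>A H = H Q\<close>, this form of equitability
  does not mention the enumeration of the classes, and it applies to the indicator columns of any
  coarser partition.
\<close>
lemma equitable_partition_class_constant:
  assumes EP: "equitable_partition n A P" and A: "A \<in> carrier_mat n n"
    and x: "x \<in> carrier_vec n" "class_constant P x"
  shows "class_constant P (A *\<^sub>v x)"
proof -
  obtain H Q where P: "partition_on {..<n} P" and H: "is_indicator_mat n P H"
    and Q: "Q \<in> carrier_mat (card P) (card P)" and AH: "A * H = H * Q"
    using EP by (auto simp: equitable_partition_def)
  have Hc: "H \<in> carrier_mat n (card P)" using is_indicator_matE[OF H P] .
  obtain v where v: "v \<in> carrier_vec (card P)" "x = H *\<^sub>v v"
    using mat_span_indicator_iff[OF H P x(1)] x(2) Hc by (auto simp: mat_span_def)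
  have "A *\<^sub>v x = (A * H) *\<^sub>v v" using A Hc v by simp
  also have "\<dots> = H *\<^sub>v (Q *\<^sub>v v)" unfolding AH using Hc Q v by simp
  finally have "A *\<^sub>v x \<in> mat_span H" using Q v Hc by (auto simp: mat_span_def)
  then show ?thesis using mat_span_indicator_iff[OF H P] A x by simp
qed

lemma in_mat_span_indicator_iff:
  assumes H: "is_indicator_mat n P H" and P: "partition_on {..<n} P"
    and X: "X \<in> carrier_mat n m"
  shows "in_mat_span X H \<longleftrightarrow> (\<forall>C\<in>P. \<forall>i\<in>C. \<forall>j\<in>C. row X i = row X j)"
proof -
  have "col X k \<in> mat_span H \<longleftrightarrow> class_constant P (col X k)" if "k < m" for k
    by (rule mat_span_indicator_iff[OF H P]) (use X in auto)
  then show ?thesis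
    unfolding class_constant_cols_iff[OF X P, symmetric] in_mat_span_def using X by simp
qed

text \<open>
  The columns of the quotient matrix \<open>Q\<close> are the coefficient vectors that express the columns of
  \<open>A H\<close> through those of \<open>H\<close>.
\<close>
lemma equitable_partitionI:
  assumes H: "is_indicator_mat n P H" and P: "partition_on {..<n} P"
    and A: "A \<in> carrier_mat n n" and span: "in_mat_span (A * H) H"
  shows "equitable_partition n A P"
proof -
  have Hc: "H \<in> carrier_mat n (card P)" using is_indicator_matE[OF H P] .
  have "col (A * H) j \<in> mat_span H" if "j < card P" for j
    using span Hc that unfolding in_mat_span_def by simp
  then have "\<forall>j<card P. \<exists>v. v \<in> carrier_vec (card P) \<and> col (A * H) j = H *\<^sub>v v"
    using Hc unfolding mat_span_def by fastforce
  then obtain v where v: "\<And>j. j < card P \<Longrightarrow> v j \<in> carrier_vec (card P)"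
      "\<And>j. j < card P \<Longrightarrow> col (A * H) j = H *\<^sub>v v j"
    by metis
  define Q where "Q = mat_of_cols (card P) (map v [0..<card P])"
  have Qc: "Q \<in> carrier_mat (card P) (card P)" by (simp add: Q_def mat_of_cols_def)
  have "A * H = H * Q"
  proof (rule mat_col_eqI)
    fix j assume "j < dim_col (H * Q)"
    then have j: "j < card P" using Qc by simp
    then have "col Q j = v j" using v by (simp add: Q_def)
    then show "col (A * H) j = col (H * Q) j" using v(2)[OF j] col_mult2[OF Hc Qc j] by simp
  qed (use A Hc Qc in auto)
  then show ?thesis using H P Qc by (auto simp: equitable_partition_def)
qed

section \<open>One round of refinement\<close>

lemma remdups_map_inj_on:
  assumes "inj_on f (set xs)"
  shows "remdups (map f xs) = map f (remdups xs)"
proof -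
  have "remdups (map f xs) = remdups (map f (remdups xs))" by (simp add: remdups_map_remdups)
  also have "\<dots> = map f (remdups xs)" using assms by (simp add: distinct_map)
  finally show ?thesis .
qed

text \<open>
  Column \<open>j\<close> is the characteristic vector of the class of \<open>j\<close>, and distinct classes have distinct
  characteristic vectors; so removing duplicates leaves one column for each class.
\<close>
lemma remove_duplicate_cols_equiv:
  assumes R: "equiv {..<n} R"
  shows "is_indicator_mat n ({..<n} // R)
           (remove_duplicate_cols (mat n n (\<lambda>(i, j). if (i, j) \<in> R then 1 else 0)))"
proof -
  let ?M = "mat n n (\<lambda>(i, j). if (i, j) \<in> R then 1 else 0) :: real mat"
  define chi :: "nat set \<Rightarrow> real vec" where "chi C = vec n (\<lambda>i. if i \<in> C then 1 else 0)" for C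
  define Cs where "Cs = remdups (map (\<lambda>j. R `` {j}) [0..<n])"
  have sub: "C \<subseteq> {..<n}" if "C \<in> set Cs" for C
    using that R by (auto simp: Cs_def equiv_def refl_on_def)
  have inj: "inj_on chi (set Cs)"
  proof (rule inj_onI)
    fix C D assume CD: "C \<in> set Cs" "D \<in> set Cs" "chi C = chi D"
    have "i \<in> C \<longleftrightarrow> i \<in> D" if "i < n" for i
    proof -
      have "chi C $ i = chi D $ i" using CD(3) by simp
      then show ?thesis using that by (simp add: chi_def split: if_splits)
    qed
    then show "C = D" using sub CD by blast
  qed
  have "cols ?M = map chi (map (\<lambda>j. R `` {j}) [0..<n])"
  proof (rule nth_equalityI)
    fix j assume "j < length (cols ?M)"
    then show "cols ?M ! j = map chi (map (\<lambda>j. R `` {j}) [0..<n]) ! j"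
      using R by (auto simp: chi_def vec_eq_iff equiv_def dest: symD)
  qed simp
  then have "remdups (cols ?M) = map chi Cs"
    using inj remdups_map_inj_on[of chi "map (\<lambda>j. R `` {j}) [0..<n]"] by (simp add: Cs_def)
  then have "remove_duplicate_cols ?M = indicator_mat n Cs"
    by (auto simp: remove_duplicate_cols_def indicator_mat_def mat_of_cols_def chi_def)
  moreover have "distinct Cs" "set Cs = {..<n} // R"
    by (auto simp: Cs_def quotient_def)
  ultimately show ?thesis by (auto simp: is_indicator_mat_def)
qed

text \<open>
  Equitable partitions stay finer than the current one because \<open>A\<close> maps the columns of \<open>B\<close>, being
  constant on the classes of an equitable \<open>P'\<close>, to vectors that are again constant there. The number
  of classes grows because a round without a split would mean that the rows of \<open>A B\<close> agree within the
  classes of \<open>P\<close>, against the failed test.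
\<close>
lemma refinement_round:
  assumes A: "A \<in> carrier_mat n n" and B: "is_indicator_mat n P B"
    and P: "partition_on {..<n} P"
    and EP: "\<And>P'. equitable_partition n A P' \<Longrightarrow> refines {..<n} P' P"
    and nspan: "\<not> in_mat_span (A * B) B"
  obtains P2 where
    "is_indicator_mat n P2 (remove_duplicate_cols (refine_mat n (\<lambda>X. A * X) B))"
    "partition_on {..<n} P2" "card P < card P2"
    "\<And>P'. equitable_partition n A P' \<Longrightarrow> refines {..<n} P' P2"
proof -
  have Bc: "B \<in> carrier_mat n (card P)" using is_indicator_matE[OF B P] .
  then have ABc: "A * B \<in> carrier_mat n (card P)" using A by simp
  define R where "R = {(i, j). i < n \<and> j < n \<and> row (A * B) i = row (A * B) j \<and> row B i = row B j}"
  have R: "equiv {..<n} R" by (auto simp: R_def equiv_def refl_on_def sym_def trans_def)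
  define P2 where "P2 = {..<n} // R"
  have P2: "partition_on {..<n} P2" unfolding P2_def using R by (rule partition_on_quotient)
  have "refine_mat n (\<lambda>X. A * X) B = mat n n (\<lambda>(i, j). if (i, j) \<in> R then 1 else 0)"
    by (auto simp: refine_mat_def R_def)
  then have ind: "is_indicator_mat n P2 (remove_duplicate_cols (refine_mat n (\<lambda>X. A * X) B))"
    using remove_duplicate_cols_equiv[OF R] by (simp add: P2_def)
  have finer: "refines {..<n} P' P2"
    if P': "partition_on {..<n} P'" and sub: "\<And>C i j. C \<in> P' \<Longrightarrow> i \<in> C \<Longrightarrow> j \<in> C \<Longrightarrow> (i, j) \<in> R" for P'
    unfolding refines_def
  proof (intro conjI ballI P' P2)
    fix C assume C: "C \<in> P'"
    then obtain i where i: "i \<in> C" using partition_onD3[OF P'] by fastforce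
    then have "C \<subseteq> R `` {i}" using sub[OF C i] by blast
    moreover have "R `` {i} \<in> P2"
      unfolding P2_def using sub[OF C i i] by (intro quotientI) (simp add: R_def)
    ultimately show "\<exists>Y\<in>P2. C \<subseteq> Y" by blast
  qed
  have ref: "refines {..<n} P2 P"
    unfolding refines_def
  proof (intro conjI ballI P P2)
    fix C assume "C \<in> P2"
    then obtain i where i: "i < n" "C = R `` {i}" by (auto simp: P2_def quotient_def)
    then obtain D where D: "D \<in> P" "i \<in> D" using P by (auto simp: partition_on_def)
    have "C \<subseteq> D"
    proof
      fix j assume "j \<in> C"
      then have "j < n" "row B i = row B j" using i by (auto simp: R_def)
      then show "j \<in> D"
        using row_indicator_mat_eq_iff[OF B P i(1)] partition_on_same_class[OF P] D by blast
    qed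
    then show "\<exists>Y\<in>P. C \<subseteq> Y" using D by blast
  qed
  have "P2 \<noteq> P"
  proof
    assume eq: "P2 = P"
    have "row (A * B) i = row (A * B) j" if "C \<in> P" "i \<in> C" "j \<in> C" for C i j
    proof -
      have "(i, j) \<in> R"
        using that R quotient_eq_iff[OF R, of C C i j] by (simp add: eq[symmetric] P2_def)
      then show ?thesis by (simp add: R_def)
    qed
    then show False using nspan in_mat_span_indicator_iff[OF B P ABc] by blast
  qed
  then have card: "card P < card P2"
    using refines_card[OF _ ref] by fastforce
  have "refines {..<n} P' P2" if P': "equitable_partition n A P'" for P'
  proof (rule finer)
    show part: "partition_on {..<n} P'" using P' by (simp add: equitable_partition_def)
    have ref': "refines {..<n} P' P" using EP P' .
    have "class_constant P' (col B k) \<and> class_constant P' (col (A * B) k)" if k: "k < card P" for k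
    proof -
      have "class_constant P (col B k)" using class_constant_col_indicator[OF B P k] .
      then have const: "class_constant P' (col B k)"
        using ref' unfolding refines_def class_constant_def by (meson subsetD)
      then have "class_constant P' (A *\<^sub>v col B k)"
        using equitable_partition_class_constant[OF P' A] Bc k by auto
      then show ?thesis using const col_mult2[OF A Bc k] by simp
    qed
    then have rows: "\<forall>C\<in>P'. \<forall>i\<in>C. \<forall>j\<in>C. row B i = row B j"
      "\<forall>C\<in>P'. \<forall>i\<in>C. \<forall>j\<in>C. row (A * B) i = row (A * B) j"
      unfolding class_constant_cols_iff[OF Bc part, symmetric]
        class_constant_cols_iff[OF ABc part, symmetric] by auto
    fix C i j assume C: "C \<in> P'" "i \<in> C" "j \<in> C"
    then have "i < n" "j < n" using part by (auto simp: partition_on_def)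
    moreover have "row (A * B) i = row (A * B) j" "row B i = row B j" using rows C by blast+
    ultimately show "(i, j) \<in> R" by (simp add: R_def)
  qed
  with that[OF ind P2 card] show ?thesis by blast
qed

section \<open>The loop computes the coarsest equitable partition\<close>

lemma unique_coarsest_EP:
  assumes P: "equitable_partition n A P"
    and EP: "\<And>P'. equitable_partition n A P' \<Longrightarrow> refines {..<n} P' P"
  shows "coarsest_EP n A P' \<longleftrightarrow> P' = P"
proof
  have P_le: "card P \<le> card P'" if "equitable_partition n A P'" for P'
    using refines_card(1)[OF _ EP[OF that]] by simp
  then show "coarsest_EP n A P'" if "P' = P"
    using P that by (simp add: coarsest_EP_def)
  assume P': "coarsest_EP n A P'"
  then have "card P' = card P" "refines {..<n} P' P"
    using P_le P EP by (auto simp: coarsest_EP_def intro: antisym)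
  then show "P' = P" using refines_card(2) by blast
qed

theorem mainTheorem2:
  fixes n :: nat and E :: "nat set set" and w :: "nat set \<Rightarrow> real" and A :: "real mat"
  assumes "weighted_graph n E w"
    and "A = adjacency_mat n E w"
  shows "\<exists>B. blindWL n (\<lambda>X. A * X) = Some B \<and>
           (\<exists>!P. coarsest_EP n A P) \<and>
           (\<forall>P. coarsest_EP n A P \<longrightarrow> is_indicator_mat n P B)"
proof -
  have n: "0 < n" using assms(1) by (simp add: weighted_graph_def)
  have A: "A \<in> carrier_mat n n" by (simp add: assms(2) adjacency_mat_def)
  define Inv where "Inv B \<longleftrightarrow> (\<exists>P. is_indicator_mat n P B \<and> partition_on {..<n} P \<and>
      (\<forall>P'. equitable_partition n A P' \<longrightarrow> refines {..<n} P' P))" for B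
  define step where "step B = remove_duplicate_cols (refine_mat n (\<lambda>X. A * X) B)" for B
  have Inv_step: "Inv (step B) \<and> n - dim_col (step B) < n - dim_col B"
    if B: "Inv B" and nspan: "\<not> in_mat_span (A * B) B" for B
  proof -
    from B obtain P where P: "is_indicator_mat n P B" "partition_on {..<n} P"
      "\<And>P'. equitable_partition n A P' \<Longrightarrow> refines {..<n} P' P"
      by (auto simp: Inv_def)
    obtain P2 where P2: "is_indicator_mat n P2 (step B)" "partition_on {..<n} P2"
      "card P < card P2" "\<And>P'. equitable_partition n A P' \<Longrightarrow> refines {..<n} P' P2"
      using refinement_round[OF A P nspan] unfolding step_def by metis
    have "dim_col B = card P" "dim_col (step B) = card P2"
      using is_indicator_matE[OF P(1,2)] is_indicator_matE[OF P2(1,2)] carrier_matD(2) by metis+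
    \<comment> \<open>With truncated subtraction, \<open>n - card P2 < n - card P\<close> requires \<open>card P < n\<close>.\<close>
    moreover have "card P2 \<le> n"
    proof -
      have "refines {..<n} ((\<lambda>i. {i}) ` {..<n}) P2"
        using P2(2) partition_on_singletons by (auto simp: refines_def partition_on_def)
      then have "card P2 \<le> card ((\<lambda>i. {i}) ` {..<n})" by (rule refines_card(1)[rotated]) simp
      also have "\<dots> \<le> card {..<n}" by (rule card_image_le) simp
      finally show ?thesis by simp
    qed
    ultimately show ?thesis using P2 by (auto simp: Inv_def)
  qed
  have init: "Inv (mat n 1 (\<lambda>_. 1))"
    unfolding Inv_def
  proof (intro exI conjI allI impI)
    show "is_indicator_mat n {{..<n}} (mat n 1 (\<lambda>_. 1))"
      unfolding is_indicator_mat_def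
      by (rule exI[of _ "[{..<n}]"]) (auto simp: indicator_mat_def)
    show part: "partition_on {..<n} {{..<n}}" using n by (intro partition_on_space) auto
    fix P' assume "equitable_partition n A P'"
    then show "refines {..<n} P' {{..<n}}"
      using part by (auto simp: equitable_partition_def refines_def partition_on_def)
  qed
  have loop: "blindWL n (\<lambda>X. A * X) =
      while_option (\<lambda>B. \<not> in_mat_span (A * B) B) step (mat n 1 (\<lambda>_. 1))"
    by (simp add: blindWL_def step_def[abs_def])
  have "\<exists>B. blindWL n (\<lambda>X. A * X) = Some B"
    unfolding loop
    by (rule measure_while_option_Some[where P = Inv and f = "\<lambda>B. n - dim_col B", OF Inv_step init])
  then obtain B where res: "blindWL n (\<lambda>X. A * X) = Some B" by (rule exE)
  have "Inv B"
    by (rule while_option_rule[where P = Inv, OF _ res[unfolded loop] init])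
      (rule conjunct1[OF Inv_step])
  then obtain P where P: "is_indicator_mat n P B" "partition_on {..<n} P"
    "\<And>P'. equitable_partition n A P' \<Longrightarrow> refines {..<n} P' P"
    by (auto simp: Inv_def)
  have "in_mat_span (A * B) B"
    using while_option_stop[OF res[unfolded loop]] by simp
  then have "equitable_partition n A P" using equitable_partitionI[OF P(1,2) A] by simp
  then have "coarsest_EP n A P' \<longleftrightarrow> P' = P" for P' using unique_coarsest_EP P(3) by blast
  then show ?thesis using res P(1) by auto
qed

end
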